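(* Let $n\ge 0$ be an integer, $\theta\in(0,\pi)$, $J=\{e^{it}: t\in[-\theta,\theta]\}$, $I=\mathbb{T}\setminus J$ and $f\in L^2(I)$. For $m\ge 1$ set $t_k=-\theta+\frac{2k\theta}{m}$ for $k=0,\dots,m$, and $J_m=\{e^{it_k}: 0\le k\le m\}$. For $\lambda=(\lambda_0,\dots,\lambda_m)\in\mathbb{R}^{m+1}$ and $g\in P_n$ define the Lagrangian $$L(\lambda,g)=\|f-g\|_{L^2(I)}+\sum_{k=0}^m\lambda_k\left(|g(e^{it_k})|^2-1\right).$$ Then: (1) Problem DBEP(n,m) has a unique solution $k_{n,m}$: there is exactly one $k_{n,m}\in P_n$ with $|k_{n,m}|\le1$ on $J_m$ such that $$\|f-k_{n,m}\|_{L^2(I)}=\min\{\|f-g\|_{L^2(I)}:\ g\in P_n,\ |g|\le1\text{ on }J_m\}.$$ (2) $k_{n,m}$ is also the unique solution $g_{opt}$ of the concave maximization problem of finding $g_{opt}\in P_n$ and $\lambda_{opt}\ge 0$ solving $$\max_{\lambda\ge0}\ \min_{g\in P_n}L(\lambda,g),$$ where $\lambda\ge0$ means that each component of $\lambda$ is non-negative; that is, the concave function $\lambda\mapsto\min_{g\in P_n}L(\lambda,g)$ attains its maximum over $\lambda\ge0$, and for any maximizer $\lambda_{opt}$ the minimum of $L(\lambda_{opt},\cdot)$ over $P_n$ is attained at $k_{n,m}$ and only there. (3) For fixed $n$, $\lim_{m\to\infty}k_{n,m}=k_n$ in $P_n$, where $k_n$ is the solution to PBEP(n).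
   Context: $\mathbb{T}$ is the unit circle. All functions are complex-valued. $\|f\|_{L^2(I)}=\left(\frac1{2\pi}\int_I|f(e^{i\theta})|^2\,d\theta\right)^{1/2}$. $P_n$ is the (finite-dimensional) space of complex algebraic polynomials of degree at most $n$. Problem PBEP(n): given $f\in L^2(I)$, find $k_n\in P_n$ with $|k_n|\le 1$ a.e. on $J$ such that $\|f-k_n\|_{L^2(I)}=\inf\{\|f-g\|_{L^2(I)}:\ g\in P_n,\ |g|\le 1\text{ a.e. on }J\}$. This problem has a unique solution. *)

theory Defs
  imports "HOL-Analysis.Analysis" "HOL-Computational_Algebra.Polynomial"
begin

definition arcJ :: "real \<Rightarrow> complex set" where
  "arcJ \<theta> = cis ` {-\<theta>..\<theta>}"

definition arcI :: "real \<Rightarrow> complex set" where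
  "arcI \<theta> = sphere 0 1 - arcJ \<theta>"

text \<open>Subsets \<open>A\<close> of the unit circle are measured through the parametrisation
  \<open>cis\<close> on the period \<open>(-\<pi>, \<pi>]\<close>.\<close>

definition angles :: "complex set \<Rightarrow> real set" where
  "angles A = {t \<in> {-pi<..pi}. cis t \<in> A}"

text \<open>Functions in \<open>L\<^sup>2(A)\<close> are represented by arbitrary measurable representatives;
  their values off \<open>A\<close> play no role.\<close>

definition in_L2 :: "complex set \<Rightarrow> (complex \<Rightarrow> complex) \<Rightarrow> bool" where
  "in_L2 A f \<longleftrightarrow>
     set_borel_measurable lebesgue (angles A) (\<lambda>t. f (cis t)) \<and>
     set_integrable lebesgue (angles A) (\<lambda>t. (cmod (f (cis t)))\<^sup>2)"

definition L2_norm :: "complex set \<Rightarrow> (complex \<Rightarrow> complex) \<Rightarrow> real" where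
  "L2_norm A f =
     sqrt (1 / (2 * pi) * (LINT t:angles A|lebesgue. (cmod (f (cis t)))\<^sup>2))"

definition polys :: "nat \<Rightarrow> complex poly set" where
  "polys n = {p. degree p \<le> n}"

definition err :: "real \<Rightarrow> (complex \<Rightarrow> complex) \<Rightarrow> complex poly \<Rightarrow> real" where
  "err \<theta> f g = L2_norm (arcI \<theta>) (\<lambda>z. f z - poly g z)"

definition pbep_feasible :: "real \<Rightarrow> nat \<Rightarrow> complex poly set" where
  "pbep_feasible \<theta> n =
     {g \<in> polys n. AE t in lebesgue. t \<in> angles (arcJ \<theta>) \<longrightarrow> cmod (poly g (cis t)) \<le> 1}"

definition is_pbep_solution ::
  "real \<Rightarrow> (complex \<Rightarrow> complex) \<Rightarrow> nat \<Rightarrow> complex poly \<Rightarrow> bool" where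
  "is_pbep_solution \<theta> f n k \<longleftrightarrow>
     k \<in> pbep_feasible \<theta> n \<and> err \<theta> f k = (INF g\<in>pbep_feasible \<theta> n. err \<theta> f g)"

definition pbep_solution :: "real \<Rightarrow> (complex \<Rightarrow> complex) \<Rightarrow> nat \<Rightarrow> complex poly" where
  "pbep_solution \<theta> f n = (THE k. is_pbep_solution \<theta> f n k)"

definition node :: "real \<Rightarrow> nat \<Rightarrow> nat \<Rightarrow> real" where
  "node \<theta> m k = -\<theta> + 2 * real k * \<theta> / real m"

definition arcJ_disc :: "real \<Rightarrow> nat \<Rightarrow> complex set" where
  "arcJ_disc \<theta> m = (\<lambda>k. cis (node \<theta> m k)) ` {0..m}"

definition dbep_feasible :: "real \<Rightarrow> nat \<Rightarrow> nat \<Rightarrow> complex poly set" where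
  "dbep_feasible \<theta> n m = {g \<in> polys n. \<forall>z\<in>arcJ_disc \<theta> m. cmod (poly g z) \<le> 1}"

definition is_dbep_solution ::
  "real \<Rightarrow> (complex \<Rightarrow> complex) \<Rightarrow> nat \<Rightarrow> nat \<Rightarrow> complex poly \<Rightarrow> bool" where
  "is_dbep_solution \<theta> f n m k \<longleftrightarrow>
     is_arg_min (err \<theta> f) (\<lambda>g. g \<in> dbep_feasible \<theta> n m) k"

definition dbep_solution ::
  "real \<Rightarrow> (complex \<Rightarrow> complex) \<Rightarrow> nat \<Rightarrow> nat \<Rightarrow> complex poly" where
  "dbep_solution \<theta> f n m = (THE k. is_dbep_solution \<theta> f n m k)"

text \<open>A multiplier \<open>\<lambda> \<in> \<real>\<^sup>m\<^sup>+\<^sup>1\<close> is a function on \<open>nat\<close> of which only the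
  values at \<open>0, \<dots>, m\<close> are used.\<close>

definition lagrangian ::
  "real \<Rightarrow> (complex \<Rightarrow> complex) \<Rightarrow> nat \<Rightarrow> (nat \<Rightarrow> real) \<Rightarrow> complex poly \<Rightarrow> real" where
  "lagrangian \<theta> f m l g =
     err \<theta> f g + (\<Sum>k=0..m. l k * ((cmod (poly g (cis (node \<theta> m k))))\<^sup>2 - 1))"

definition nonneg_mult :: "nat \<Rightarrow> (nat \<Rightarrow> real) set" where
  "nonneg_mult m = {l. \<forall>k\<in>{0..m}. 0 \<le> l k}"

text \<open>This infimum represents \<open>min\<^sub>g L(\<lambda>, g)\<close> only when it is attained,
  which has to be asserted separately.\<close>

definition dual_fun ::
  "real \<Rightarrow> (complex \<Rightarrow> complex) \<Rightarrow> nat \<Rightarrow> nat \<Rightarrow> (nat \<Rightarrow> real) \<Rightarrow> real" where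
  "dual_fun \<theta> f n m l = (INF g\<in>polys n. lagrangian \<theta> f m l g)"

text \<open>Concavity is spelled out because \<open>nat \<Rightarrow> real\<close> is not an instance of
  \<open>real_vector\<close>, as \<open>concave_on\<close> would require.\<close>

definition concave_on_mult :: "nat \<Rightarrow> ((nat \<Rightarrow> real) \<Rightarrow> real) \<Rightarrow> bool" where
  "concave_on_mult m q \<longleftrightarrow>
     (\<forall>l\<in>nonneg_mult m. \<forall>l'\<in>nonneg_mult m. \<forall>u\<ge>0. \<forall>v\<ge>0. u + v = 1 \<longrightarrow>
        u * q l + v * q l' \<le> q (\<lambda>k. u * l k + v * l' k))"

end

theory Submission
  imports Defs
begin

text \<open>On polynomials of degree at most \<open>n\<close> the \<open>L\<^sup>2(I)\<close> norm dominates the coefficients, since a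
  polynomial vanishing almost everywhere on \<open>I\<close> is zero. So bounded errors give coefficientwise
  convergent subsequences, which yields minimisers, and the parallelogram law makes them unique.

  Strong duality needs no separation theorem. The dual function is upper semicontinuous and, as
  \<open>L(\<lambda>,0) = \<parallel>f\<parallel> - \<Sum>\<lambda>\<^sub>k\<close>, tends to \<open>-\<infinity>\<close>, so it has a maximiser \<open>\<lambda>\<close>. Perturbing one component of \<open>\<lambda>\<close>
  moves the unique minimiser of the Lagrangian continuously, so maximality of \<open>\<lambda>\<close> forces
  \<open>|g(z\<^sub>k)| \<le> 1\<close>, with equality where \<open>\<lambda>\<^sub>k > 0\<close>; hence the minimiser \<open>g\<close> solves the discrete problem.

  Refinement: \<open>k\<^sub>n\<close> is feasible for every discrete problem, so the \<open>k\<^sub>n\<^sub>,\<^sub>m\<close> are bounded, and every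
  cluster point is feasible on \<open>J\<close> with error at most that of \<open>k\<^sub>n\<close>, hence equals \<open>k\<^sub>n\<close>.\<close>

subsection \<open>The \<open>L\<^sup>2\<close> seminorm\<close>

lemma L2_norm_nonneg: "0 \<le> L2_norm A f"
  unfolding L2_norm_def set_lebesgue_integral_def
  by (auto intro!: integral_nonneg)

lemma L2_norm_power2:
  "(L2_norm A f)\<^sup>2 = 1 / (2 * pi) * (LINT t:angles A|lebesgue. (cmod (f (cis t)))\<^sup>2)"
  unfolding L2_norm_def set_lebesgue_integral_def
  by (subst real_sqrt_pow2) (auto intro!: integral_nonneg)

text \<open>The gap between the two sides is a square divided by \<open>u * (1 - u)\<close>.
  Integrated, and with \<open>u\<close> well chosen, this becomes Minkowski's inequality.\<close>

lemma weighted_square_sum_le: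
  fixes a b u :: real
  assumes "0 < u" "u < 1"
  shows "(a + b)\<^sup>2 \<le> a\<^sup>2 / u + b\<^sup>2 / (1 - u)"
proof -
  have "a\<^sup>2 / u + b\<^sup>2 / (1 - u) - (a + b)\<^sup>2 = ((1 - u) * a - u * b)\<^sup>2 / (u * (1 - u))"
    using assms by (simp add: divide_simps) (simp add: algebra_simps power2_eq_square)
  also have "\<dots> \<ge> 0"
    using assms by simp
  finally show ?thesis
    by simp
qed

lemma cmod_add_power2_le:
  assumes "0 < u" "u < 1"
  shows "(cmod (x + y))\<^sup>2 \<le> (cmod x)\<^sup>2 / u + (cmod y)\<^sup>2 / (1 - u)"
  using weighted_square_sum_le[OF assms, of "cmod x" "cmod y"]
    power_mono[OF norm_triangle_ineq[of x y] norm_ge_zero, of 2]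
  by linarith

lemma in_L2_add:
  assumes "in_L2 A f" "in_L2 A g"
  shows "in_L2 A (\<lambda>z. f z + g z)"
proof -
  have meas: "set_borel_measurable lebesgue (angles A) (\<lambda>t. f (cis t) + g (cis t))"
    using assms borel_measurable_add unfolding in_L2_def set_borel_measurable_def scaleR_add_right
    by blast
  have m2: "set_borel_measurable lebesgue (angles A) (\<lambda>t. (cmod (f (cis t) + g (cis t)))\<^sup>2)"
  proof -
    \<comment> \<open>Only products with the indicator are known to be measurable, so the indicator
      is moved inside the norm and the square.\<close>
    have "(\<lambda>t. indicator (angles A) t *\<^sub>R (cmod (f (cis t) + g (cis t)))\<^sup>2)
      = (\<lambda>t. (cmod (indicator (angles A) t *\<^sub>R (f (cis t) + g (cis t))))\<^sup>2)"
      by (auto simp: indicator_def)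
    moreover have "(\<lambda>t. (cmod (indicator (angles A) t *\<^sub>R (f (cis t) + g (cis t))))\<^sup>2)
        \<in> borel_measurable lebesgue"
      using meas unfolding set_borel_measurable_def
      by (rule borel_measurable_power[OF measurable_compose[OF _ borel_measurable_norm]])
    ultimately show ?thesis
      unfolding set_borel_measurable_def by simp
  qed
  \<comment> \<open>The dominating function comes from the weighted inequality with
    \<open>u = 1/2\<close>.\<close>
  have i2: "set_integrable lebesgue (angles A)
      (\<lambda>t. 2 * (cmod (f (cis t)))\<^sup>2 + 2 * (cmod (g (cis t)))\<^sup>2)"
    using assms unfolding in_L2_def by (intro set_integral_add) auto
  have "set_integrable lebesgue (angles A) (\<lambda>t. (cmod (f (cis t) + g (cis t)))\<^sup>2)"
    using cmod_add_power2_le[of "1/2"]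
    by (intro set_integrable_bound[OF i2 m2]) (auto simp: mult.commute)
  with meas show ?thesis
    by (simp add: in_L2_def)
qed

lemma in_L2_cmult:
  assumes "in_L2 A f"
  shows "in_L2 A (\<lambda>z. c * f z)"
proof -
  have "(\<lambda>t. c * (indicator (angles A) t *\<^sub>R f (cis t))) \<in> borel_measurable lebesgue"
    using assms unfolding in_L2_def set_borel_measurable_def by (intro borel_measurable_times) auto
  with assms show ?thesis
    unfolding in_L2_def set_borel_measurable_def by (simp add: norm_mult power_mult_distrib)
qed

lemma in_L2_diff:
  assumes "in_L2 A f" "in_L2 A g"
  shows "in_L2 A (\<lambda>z. f z - g z)"
  using in_L2_add[OF assms(1) in_L2_cmult[OF assms(2), of "-1"]] by simp

lemma L2_norm_minus_commute: "L2_norm A (\<lambda>z. f z - g z) = L2_norm A (\<lambda>z. g z - f z)"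
  by (simp add: L2_norm_def norm_minus_commute)

lemma L2_norm_cmult: "L2_norm A (\<lambda>z. c * f z) = cmod c * L2_norm A f"
  by (simp add: L2_norm_def norm_mult power_mult_distrib real_sqrt_mult real_sqrt_divide ac_simps)

text \<open>Integrates a pointwise identity. The form with a mean is chosen because the residual of
  a midpoint polynomial is the mean of two residuals.\<close>

lemma L2_norm_parallelogram:
  assumes "in_L2 A f" "in_L2 A g"
  shows "(L2_norm A (\<lambda>z. (f z + g z) / 2))\<^sup>2
    = ((L2_norm A f)\<^sup>2 + (L2_norm A g)\<^sup>2) / 2 - (L2_norm A (\<lambda>z. f z - g z))\<^sup>2 / 4"
proof -
  let ?A = "angles A"
  have pt: "(cmod ((x + y) / 2))\<^sup>2 = ((cmod x)\<^sup>2 / 2 + (cmod y)\<^sup>2 / 2) - (cmod (x - y))\<^sup>2 / 4" for x y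
    unfolding cmod_power2 by (simp add: power2_eq_square field_simps)
  have i: "set_integrable lebesgue ?A (\<lambda>t. (cmod (f (cis t)))\<^sup>2)"
    "set_integrable lebesgue ?A (\<lambda>t. (cmod (g (cis t)))\<^sup>2)"
    "set_integrable lebesgue ?A (\<lambda>t. (cmod (f (cis t) - g (cis t)))\<^sup>2)"
    using assms in_L2_diff[OF assms] by (auto simp: in_L2_def)
  have "(LINT t:?A|lebesgue. (cmod ((f (cis t) + g (cis t)) / 2))\<^sup>2)
    = (LINT t:?A|lebesgue. (cmod (f (cis t)))\<^sup>2) / 2 + (LINT t:?A|lebesgue. (cmod (g (cis t)))\<^sup>2) / 2
      - (LINT t:?A|lebesgue. (cmod (f (cis t) - g (cis t)))\<^sup>2) / 4"
    unfolding pt using i by (simp add: set_integral_add set_integral_diff)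
  then show ?thesis
    unfolding L2_norm_power2 by (simp only: right_diff_distrib distrib_left) simp
qed

lemma L2_norm_add_power2_le:
  assumes "in_L2 A f" "in_L2 A g" "0 < u" "u < 1"
  shows "(L2_norm A (\<lambda>z. f z + g z))\<^sup>2 \<le> (L2_norm A f)\<^sup>2 / u + (L2_norm A g)\<^sup>2 / (1 - u)"
proof -
  let ?A = "angles A"
  have i: "set_integrable lebesgue ?A (\<lambda>t. (cmod (f (cis t)))\<^sup>2)"
    "set_integrable lebesgue ?A (\<lambda>t. (cmod (g (cis t)))\<^sup>2)"
    "set_integrable lebesgue ?A (\<lambda>t. (cmod (f (cis t) + g (cis t)))\<^sup>2)"
    using assms in_L2_add[OF assms(1,2)] by (auto simp: in_L2_def)
  have "(LINT t:?A|lebesgue. (cmod (f (cis t) + g (cis t)))\<^sup>2)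
    \<le> (LINT t:?A|lebesgue. (cmod (f (cis t)))\<^sup>2 / u + (cmod (g (cis t)))\<^sup>2 / (1 - u))"
    using i cmod_add_power2_le[OF assms(3,4)] by (intro set_integral_mono set_integral_add) auto
  also have "\<dots> = (LINT t:?A|lebesgue. (cmod (f (cis t)))\<^sup>2) / u
      + (LINT t:?A|lebesgue. (cmod (g (cis t)))\<^sup>2) / (1 - u)"
    using i by (subst set_integral_add) auto
  finally have "1 / (2 * pi) * (LINT t:?A|lebesgue. (cmod (f (cis t) + g (cis t)))\<^sup>2)
    \<le> 1 / (2 * pi) * ((LINT t:?A|lebesgue. (cmod (f (cis t)))\<^sup>2) / u
      + (LINT t:?A|lebesgue. (cmod (g (cis t)))\<^sup>2) / (1 - u))"
    by (rule mult_left_mono) simp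
  then show ?thesis
    unfolding L2_norm_power2 by (simp only: distrib_left times_divide_eq_right)
qed

lemma L2_norm_triangle:
  assumes "in_L2 A f" "in_L2 A g"
  shows "L2_norm A (\<lambda>z. f z + g z) \<le> L2_norm A f + L2_norm A g"
proof (rule field_le_epsilon)
  fix e :: real assume "0 < e"
  define a where "a = L2_norm A f + e / 2"
  define b where "b = L2_norm A g + e / 2"
  have pos: "0 < a" "0 < b" "L2_norm A f \<le> a" "L2_norm A g \<le> b"
    using \<open>0 < e\<close> L2_norm_nonneg[of A f] L2_norm_nonneg[of A g] by (auto simp: a_def b_def)
  \<comment> \<open>This weight turns the weighted inequality into Minkowski's; \<open>e\<close> keeps it inside \<open>(0,1)\<close>.\<close>
  define u where "u = a / (a + b)"
  have u: "0 < u" "u < 1" "1 - u = b / (a + b)"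
    using pos by (auto simp: u_def field_simps)
  have "(L2_norm A (\<lambda>z. f z + g z))\<^sup>2 \<le> (L2_norm A f)\<^sup>2 / u + (L2_norm A g)\<^sup>2 / (1 - u)"
    using L2_norm_add_power2_le[OF assms u(1,2)] .
  also have "\<dots> \<le> a\<^sup>2 / u + b\<^sup>2 / (1 - u)"
    using pos u L2_norm_nonneg by (intro add_mono divide_right_mono power_mono) auto
  also have "\<dots> = (a + b)\<^sup>2"
    using pos unfolding u(3) unfolding u_def by (simp add: field_simps power2_eq_square)
  finally have "L2_norm A (\<lambda>z. f z + g z) \<le> a + b"
    using pos by (auto intro: power2_le_imp_le)
  then show "L2_norm A (\<lambda>z. f z + g z) \<le> L2_norm A f + L2_norm A g + e"
    by (simp add: a_def b_def)
qed

subsection \<open>Coefficientwise convergence of polynomials\<close>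

text \<open>Bolzano-Weierstrass for one index at a time, thinning the subsequence already found. It
  serves both for coefficients and for multipliers.\<close>

lemma finite_convergent_subsequence:
  fixes x :: "nat \<Rightarrow> 'i \<Rightarrow> 'a::heine_borel"
  assumes "finite I" "\<And>i. i \<in> I \<Longrightarrow> bounded (range (\<lambda>j. x j i))"
  obtains r l where "strict_mono r" "\<And>i. i \<in> I \<Longrightarrow> (\<lambda>j. x (r j) i) \<longlonglongrightarrow> l i"
proof -
  have "\<exists>r l. strict_mono r \<and> (\<forall>i\<in>I. (\<lambda>j. x (r j) i) \<longlonglongrightarrow> l i)"
    using assms
  proof (induction I rule: finite_induct)
    case empty
    show ?case by (auto intro: strict_mono_id[unfolded id_def])
  next
    case (insert i I)
    then obtain r l where r: "strict_mono r" "\<forall>i\<in>I. (\<lambda>j. x (r j) i) \<longlonglongrightarrow> l i"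
      by auto
    have "bounded (range (\<lambda>j. x (r j) i))"
      using insert.prems[of i] by (rule bounded_subset) auto
    then obtain a s where s: "strict_mono s" "((\<lambda>j. x (r j) i) \<circ> s) \<longlonglongrightarrow> a"
      using bounded_imp_convergent_subsequence by blast
    have "strict_mono (r \<circ> s)"
      using r s by (simp add: strict_mono_o)
    moreover have "(\<lambda>j. x ((r \<circ> s) j) k) \<longlonglongrightarrow> (l(i := a)) k" if "k \<in> insert i I" for k
      using that s(2) insert.hyps LIMSEQ_subseq_LIMSEQ[OF r(2)[rule_format, of k] s(1)]
      by (auto simp: o_def)
    ultimately show ?case by blast
  qed
  then show ?thesis using that by blast
qed

text \<open>On polynomials of bounded degree this is convergence in any norm of the
  finite-dimensional space \<open>polys n\<close>.\<close>

definition coeffs_tendsto :: "(nat \<Rightarrow> complex poly) \<Rightarrow> complex poly \<Rightarrow> bool" where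
  "coeffs_tendsto p q \<longleftrightarrow> (\<forall>i. (\<lambda>j. coeff (p j) i) \<longlonglongrightarrow> coeff q i)"

lemma coeffs_tendsto_diff_const:
  "coeffs_tendsto p q \<Longrightarrow> coeffs_tendsto (\<lambda>j. p j - q) 0"
  unfolding coeffs_tendsto_def by (auto intro: LIM_zero)

lemma polys_convergent_subsequence:
  fixes p :: "nat \<Rightarrow> complex poly"
  assumes "\<And>j. p j \<in> polys n" "\<And>j i. cmod (coeff (p j) i) \<le> B"
  obtains r q where "strict_mono r" "q \<in> polys n" "coeffs_tendsto (p \<circ> r) q"
proof -
  have "bounded (range (\<lambda>j. coeff (p j) i))" for i
    using assms(2) by (auto simp: bounded_iff)
  then obtain r l where r: "strict_mono r" "\<And>i. i \<in> {..n} \<Longrightarrow> (\<lambda>j. coeff (p (r j)) i) \<longlonglongrightarrow> l i"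
    using finite_convergent_subsequence[of "{..n}" "\<lambda>j. coeff (p j)"] by auto
  define q where "q = (\<Sum>i\<le>n. monom (l i) i)"
  have cq: "coeff q i = (if i \<le> n then l i else 0)" for i
    by (simp add: q_def coeff_sum)
  have "q \<in> polys n"
    using cq by (auto simp: polys_def intro!: degree_le)
  moreover have "(\<lambda>j. coeff ((p \<circ> r) j) i) \<longlonglongrightarrow> coeff q i" for i
  proof (cases "i \<le> n")
    case True
    then show ?thesis using r(2)[of i] by (simp add: cq)
  next
    case False
    then have "coeff (p j) i = 0" for j
      using assms(1)[of j] by (auto simp: polys_def intro!: coeff_eq_0)
    then show ?thesis using False by (simp add: cq)
  qed
  ultimately show ?thesis
    using that r(1) by (auto simp: coeffs_tendsto_def)
qed

text \<open>Otherwise some coefficient stays at distance at least \<open>e\<close> from its target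
  along a subsequence; by compactness that subsequence has a cluster point, which must be
  \<open>k\<close>, a contradiction.\<close>

lemma coeffs_tendsto_if_unique_cluster_point:
  assumes "\<And>j. p j \<in> polys n" "\<And>j i. cmod (coeff (p j) i) \<le> B"
    and unique: "\<And>r q. strict_mono r \<Longrightarrow> q \<in> polys n \<Longrightarrow> coeffs_tendsto (p \<circ> r) q \<Longrightarrow> q = k"
  shows "coeffs_tendsto p k"
  unfolding coeffs_tendsto_def
proof (rule allI, rule ccontr)
  fix i assume "\<not> (\<lambda>j. coeff (p j) i) \<longlonglongrightarrow> coeff k i"
  then obtain e where e: "0 < e" "\<exists>\<^sub>F j in sequentially. e \<le> dist (coeff (p j) i) (coeff k i)"
    by (auto simp: tendsto_iff not_eventually not_less)
  then have "infinite {j. e \<le> dist (coeff (p j) i) (coeff k i)}"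
    by (simp add: frequently_cofinite[symmetric] cofinite_eq_sequentially)
  then obtain s :: "nat \<Rightarrow> nat"
    where s: "strict_mono s" "\<And>j. e \<le> dist (coeff (p (s j)) i) (coeff k i)"
    using infinite_enumerate by blast
  obtain r q where r: "strict_mono r" "q \<in> polys n" "coeffs_tendsto ((p \<circ> s) \<circ> r) q"
    using polys_convergent_subsequence[of "p \<circ> s" n B] assms(1,2) by auto
  have "q = k"
    using unique[of "s \<circ> r" q] r s(1) by (simp add: strict_mono_o o_assoc)
  with r(3) have "(\<lambda>j. coeff (p (s (r j))) i) \<longlonglongrightarrow> coeff k i"
    by (simp add: coeffs_tendsto_def)
  then have "\<forall>\<^sub>F j in sequentially. dist (coeff (p (s (r j))) i) (coeff k i) < e"
    using e(1) by (simp add: tendsto_iff)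
  then obtain j where "dist (coeff (p (s (r j))) i) (coeff k i) < e"
    using eventually_happens' sequentially_bot by blast
  with s(2)[of "r j"] show False by simp
qed

text \<open>A range of summation independent of the degree of \<open>p\<close> lets limits be taken
  term by term.\<close>

lemma poly_eq_sum_polys:
  assumes "p \<in> polys n"
  shows "poly p z = (\<Sum>i\<le>n. coeff p i * z ^ i)"
  unfolding poly_altdef using assms
  by (intro sum.mono_neutral_left) (auto simp: polys_def coeff_eq_0)

text \<open>The point may move with the index, as it does when nodes of successive grids approach a
  point of the arc.\<close>

lemma poly_tendsto:
  assumes "\<And>j. p j \<in> polys n" "q \<in> polys n" "coeffs_tendsto p q" "z \<longlonglongrightarrow> w"
  shows "(\<lambda>j. poly (p j) (z j)) \<longlonglongrightarrow> poly q w"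
  unfolding poly_eq_sum_polys[OF assms(1)] poly_eq_sum_polys[OF assms(2)]
  using assms(3,4) by (intro tendsto_sum tendsto_mult tendsto_power) (auto simp: coeffs_tendsto_def)

text \<open>The direct method: coercivity bounds the coefficients of a minimising sequence, and a
  cluster point lies in \<open>C\<close> and attains the infimum. It is applied to
  \<open>nrm\<close>, to the error and to the Lagrangian.\<close>

lemma polys_attains_min:
  fixes F :: "complex poly \<Rightarrow> real"
  assumes "C \<subseteq> polys n" "C \<noteq> {}" "0 < a"
    and coercive: "\<And>g i. g \<in> C \<Longrightarrow> cmod (coeff g i) \<le> a * F g + b"
    and lim: "\<And>p q. (\<And>j. p j \<in> C) \<Longrightarrow> q \<in> polys n \<Longrightarrow> coeffs_tendsto p q \<Longrightarrow>
      q \<in> C \<and> (\<lambda>j. F (p j)) \<longlonglongrightarrow> F q"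
  shows "\<exists>g. is_arg_min F (\<lambda>g. g \<in> C) g"
proof -
  \<comment> \<open>Coercivity also bounds \<open>F\<close> from below, because a modulus is
    nonnegative.\<close>
  have "0 \<le> a * F g + b" if "g \<in> C" for g
    using coercive[OF that, of 0] by (meson norm_ge_zero order_trans)
  then have "- b / a \<le> F g" if "g \<in> C" for g
    using that \<open>0 < a\<close> by (force simp: field_simps)
  then have bdd: "bdd_below (F ` C)"
    by (auto simp: bdd_below_def)
  define v where "v = (INF g\<in>C. F g)"
  have "\<exists>g\<in>C. F g < v + inverse (real (Suc j))" for j
    using assms(2) bdd cINF_less_iff[of C F "v + inverse (real (Suc j))"] by (auto simp: v_def)
  then obtain p where p: "\<And>j. p j \<in> C" "\<And>j. F (p j) < v + inverse (real (Suc j))"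
    by metis
  have "cmod (coeff (p j) i) \<le> a * (v + 1) + b" for j i
  proof -
    have "F (p j) \<le> v + 1"
      using p(2)[of j] by (smt (verit) inverse_le_1_iff of_nat_Suc of_nat_0_le_iff)
    then show ?thesis
      using coercive[OF p(1)[of j], of i] mult_left_mono[of "F (p j)" "v + 1" a] \<open>0 < a\<close> by linarith
  qed
  then obtain r q where r: "strict_mono r" "q \<in> polys n" "coeffs_tendsto (p \<circ> r) q"
    using polys_convergent_subsequence[of p n] p(1) assms(1) by blast
  have q: "q \<in> C" "(\<lambda>j. F ((p \<circ> r) j)) \<longlonglongrightarrow> F q"
    using lim[of "p \<circ> r" q] p(1) r by auto
  have "(\<lambda>j. v + inverse (real (Suc j))) \<longlonglongrightarrow> v"
    using tendsto_add[OF tendsto_const LIMSEQ_inverse_real_of_nat] by simp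
  then have "(\<lambda>j. v + inverse (real (Suc (r j)))) \<longlonglongrightarrow> v"
    using LIMSEQ_subseq_LIMSEQ[OF _ r(1)] by (force simp: o_def)
  then have "F q \<le> v"
    using q(2) p(2) by (intro LIMSEQ_le[OF q(2)]) (auto intro!: exI[of _ 0] less_imp_le)
  then have "F q \<le> F g" if "g \<in> C" for g
    using cINF_lower[OF bdd that] by (simp add: v_def)
  with q(1) show ?thesis
    by (auto simp: is_arg_min_linorder)
qed

subsection \<open>Polynomials bounded on subsets of the circle\<close>

text \<open>\<open>Arg\<close> inverts \<open>cis\<close> on the half-open period, which contains
  the closed parameter interval because \<open>\<theta> < pi\<close>.\<close>

lemma angles_arcJ:
  assumes "\<theta> < pi"
  shows "angles (arcJ \<theta>) = {-\<theta>..\<theta>}"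
proof -
  have "t \<in> {-\<theta>..\<theta>}" if "t \<in> {-pi<..pi}" "cis t = cis s" "s \<in> {-\<theta>..\<theta>}" for t s
  proof -
    have "t = Arg (cis t)"
      using that(1) by (simp add: Arg_cis)
    also have "\<dots> = s"
      unfolding that(2) using that(3) assms by (intro Arg_cis) auto
    finally show ?thesis
      using that(3) by simp
  qed
  with assms show ?thesis
    by (auto simp: angles_def arcJ_def)
qed

lemma angles_arcI:
  assumes "\<theta> < pi"
  shows "angles (arcI \<theta>) = {-pi<..pi} - {-\<theta>..\<theta>}"
proof -
  have "angles (arcI \<theta>) = {-pi<..pi} - angles (arcJ \<theta>)"
    by (auto simp: angles_def arcI_def)
  then show ?thesis
    by (simp only: angles_arcJ[OF assms])
qed

lemma ball_arcJ_iff: "\<theta> < pi \<Longrightarrow> (\<forall>z\<in>arcJ \<theta>. P z) \<longleftrightarrow> (\<forall>t\<in>angles (arcJ \<theta>). P (cis t))"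
  by (simp only: angles_arcJ) (simp add: arcJ_def)

lemma cmod_poly_le_sum_coeffs:
  assumes "p \<in> polys n" "cmod z = 1"
  shows "cmod (poly p z) \<le> (\<Sum>i\<le>n. cmod (coeff p i))"
  unfolding poly_eq_sum_polys[OF assms(1)] using assms(2)
  by (intro sum_norm_le) (simp add: norm_mult norm_power)

lemma in_polys_diff: "p \<in> polys n \<Longrightarrow> q \<in> polys n \<Longrightarrow> p - q \<in> polys n"
  by (auto simp: polys_def intro: degree_diff_le)

lemma in_polys_add: "p \<in> polys n \<Longrightarrow> q \<in> polys n \<Longrightarrow> p + q \<in> polys n"
  by (auto simp: polys_def intro: degree_add_le)

lemma in_polys_smult: "p \<in> polys n \<Longrightarrow> smult c p \<in> polys n"
  by (auto simp: polys_def intro: order_trans[OF degree_smult_le])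

lemma zero_in_polys: "0 \<in> polys n"
  by (simp add: polys_def)

section \<open>Convexity and closedness of the constraint sets\<close>

definition midpoint_poly :: "complex poly \<Rightarrow> complex poly \<Rightarrow> complex poly" where
  "midpoint_poly g h = smult (1 / 2) (g + h)"

lemma in_polys_midpoint: "g \<in> polys n \<Longrightarrow> h \<in> polys n \<Longrightarrow> midpoint_poly g h \<in> polys n"
  by (simp add: midpoint_poly_def in_polys_smult in_polys_add)

lemma poly_midpoint: "poly (midpoint_poly g h) z = (poly g z + poly h z) / 2"
  by (simp add: midpoint_poly_def)

text \<open>Common form of both feasible sets, with \<open>Z\<close> the arc or the set of nodes, so
  that existence and uniqueness are proved once.\<close>

definition bounded_polys :: "nat \<Rightarrow> complex set \<Rightarrow> complex poly set" where
  "bounded_polys n Z = {g \<in> polys n. \<forall>z\<in>Z. cmod (poly g z) \<le> 1}"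

lemma bounded_polys_subset: "bounded_polys n Z \<subseteq> polys n"
  by (auto simp: bounded_polys_def)

lemma zero_in_bounded_polys: "0 \<in> bounded_polys n Z"
  by (simp add: bounded_polys_def zero_in_polys)

lemma bounded_polys_midpoint:
  assumes "g \<in> bounded_polys n Z" "h \<in> bounded_polys n Z"
  shows "midpoint_poly g h \<in> bounded_polys n Z"
proof -
  have "cmod ((poly g z + poly h z) / 2) \<le> 1" if "z \<in> Z" for z
    using assms that norm_triangle_ineq[of "poly g z" "poly h z"]
    by (fastforce simp: bounded_polys_def norm_divide)
  with assms show ?thesis
    by (auto simp: bounded_polys_def in_polys_midpoint poly_midpoint)
qed

lemma bounded_polys_limit:
  assumes "\<And>j. p j \<in> bounded_polys n Z" "q \<in> polys n" "coeffs_tendsto p q"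
  shows "q \<in> bounded_polys n Z"
proof -
  have "cmod (poly q z) \<le> 1" if "z \<in> Z" for z
  proof (rule Lim_bounded)
    show "(\<lambda>j. cmod (poly (p j) z)) \<longlonglongrightarrow> cmod (poly q z)"
      using assms bounded_polys_subset by (intro tendsto_norm poly_tendsto[of p n]) auto
    show "\<forall>j\<ge>0. cmod (poly (p j) z) \<le> 1"
      using assms(1) that by (auto simp: bounded_polys_def)
  qed
  with assms(2) show ?thesis
    by (simp add: bounded_polys_def)
qed

lemma dbep_feasible_eq: "dbep_feasible \<theta> n m = bounded_polys n (arcJ_disc \<theta> m)"
  by (simp add: dbep_feasible_def bounded_polys_def)

text \<open>A set containing almost every point of an open interval is dense there. This turns
  almost-everywhere statements about continuous functions into pointwise ones.\<close>

lemma closed_superset_interval_if_AE: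
  fixes a b :: real
  assumes "closed C" "AE t\<in>{a<..<b} in lebesgue. t \<in> C"
  shows "{a<..<b} \<subseteq> C"
proof
  fix t assume "t \<in> {a<..<b}"
  then show "t \<in> C"
    by (rule mem_closed_if_AE_lebesgue_open[OF open_greaterThanLessThan assms])
qed

lemma pbep_feasible_eq:
  assumes "0 < \<theta>" "\<theta> < pi"
  shows "pbep_feasible \<theta> n = bounded_polys n (arcJ \<theta>)"
proof -
  have "cmod (poly g (cis t)) \<le> 1"
    if ae: "AE t in lebesgue. t \<in> angles (arcJ \<theta>) \<longrightarrow> cmod (poly g (cis t)) \<le> 1"
      and t: "t \<in> angles (arcJ \<theta>)" for g t
  proof -
    let ?C = "{t. cmod (poly g (cis t)) \<le> 1}"
    have "closed ?C"
      by (intro closed_Collect_le continuous_intros)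
    moreover have "AE s\<in>{- \<theta><..<\<theta>} in lebesgue. s \<in> ?C"
      using ae by eventually_elim (auto simp: angles_arcJ[OF assms(2)])
    \<comment> \<open>The open interval misses the endpoints of the arc; its closure restores
      them.\<close>
    ultimately have "closure {-\<theta><..<\<theta>} \<subseteq> ?C"
      by (intro closure_minimal closed_superset_interval_if_AE)
    with t assms show ?thesis
      by (auto simp: angles_arcJ[OF assms(2)])
  qed
  then have eq: "(AE t in lebesgue. t \<in> angles (arcJ \<theta>) \<longrightarrow> cmod (poly g (cis t)) \<le> 1)
      \<longleftrightarrow> (\<forall>z\<in>arcJ \<theta>. cmod (poly g z) \<le> 1)" for g
    unfolding ball_arcJ_iff[OF assms(2)] by (intro iffI ballI AE_I2 impI) blast+
  show ?thesis
    by (simp only: pbep_feasible_def bounded_polys_def eq)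
qed

subsection \<open>Coercivity and the parallelogram law for the error\<close>

locale extremal_problem =
  fixes \<theta> :: real and f :: "complex \<Rightarrow> complex" and n :: nat
  assumes theta_pos: "0 < \<theta>" and theta_less_pi: "\<theta> < pi"
    and f_in_L2: "in_L2 (arcI \<theta>) f"
begin

abbreviation "E \<equiv> err \<theta> f"

definition nrm :: "complex poly \<Rightarrow> real" where
  "nrm p = L2_norm (arcI \<theta>) (poly p)"

lemma nrm_nonneg: "0 \<le> nrm p"
  by (simp add: nrm_def L2_norm_nonneg)

lemma E_nonneg: "0 \<le> E p"
  by (simp add: err_def L2_norm_nonneg)

lemma nrm_smult: "nrm (smult c p) = cmod c * nrm p"
proof -
  have "poly (smult c p) = (\<lambda>z. c * poly p z)"
    by auto
  then show ?thesis
    by (simp add: nrm_def L2_norm_cmult)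
qed

lemma nrm_diff: "nrm (p - q) = L2_norm (arcI \<theta>) (\<lambda>z. poly p z - poly q z)"
proof -
  have "poly (p - q) = (\<lambda>z. poly p z - poly q z)"
    by auto
  then show ?thesis
    by (simp add: nrm_def)
qed

lemma nrm_diff_commute: "nrm (p - q) = nrm (q - p)"
  unfolding nrm_diff by (rule L2_norm_minus_commute)

section \<open>The \<open>L2_norm\<close> as a norm on polynomials\<close>

lemma angles_I: "angles (arcI \<theta>) \<in> sets lebesgue" "angles (arcI \<theta>) \<in> lmeasurable"
proof -
  show 1: "angles (arcI \<theta>) \<in> sets lebesgue"
    unfolding angles_arcI[OF theta_less_pi] by simp
  show "angles (arcI \<theta>) \<in> lmeasurable"
    using 1 by (rule bounded_set_imp_lmeasurable[rotated])
      (auto simp: angles_arcI[OF theta_less_pi] intro: bounded_subset[of "{-pi..pi}"])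
qed

lemma set_integrable_const: "set_integrable lebesgue (angles (arcI \<theta>)) (\<lambda>t. c::real)"
proof -
  have "emeasure lebesgue (angles (arcI \<theta>)) < \<infinity>"
    unfolding infinity_ennreal_def less_top[symmetric] by (rule fmeasurableD2[OF angles_I(2)])
  with angles_I(1) show ?thesis
    unfolding set_integrable_def real_scaleR_def
    by (rule integrable_mult_left[OF integrable_real_indicator])
qed

lemma continuous_poly_cis: "continuous_on A (\<lambda>t. poly p (cis t))"
  by (intro continuous_intros)

lemma in_L2_poly: "in_L2 (arcI \<theta>) (poly p)"
proof -
  let ?A = "angles (arcI \<theta>)"
  have m: "(\<lambda>t. poly p (cis t)) \<in> borel_measurable lebesgue"
    using borel_measurable_continuous_onI[OF continuous_poly_cis]
    by (simp add: measurable_completion)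
  have "set_integrable lebesgue ?A (\<lambda>t. (cmod (poly p (cis t)))\<^sup>2)"
  proof (rule set_integrable_bound[OF set_integrable_const[of "(\<Sum>i\<le>degree p. cmod (coeff p i))\<^sup>2"]])
    show "set_borel_measurable lebesgue ?A (\<lambda>t. (cmod (poly p (cis t)))\<^sup>2)"
      unfolding set_borel_measurable_def
      using m angles_I(1) by (intro borel_measurable_scaleR borel_measurable_indicator) auto
    show "AE t in lebesgue. t \<in> ?A \<longrightarrow>
        norm ((cmod (poly p (cis t)))\<^sup>2) \<le> norm ((\<Sum>i\<le>degree p. cmod (coeff p i))\<^sup>2)"
      using cmod_poly_le_sum_coeffs[of p "degree p"]
      by (auto simp: polys_def intro!: AE_I2 power_mono)
  qed
  moreover have "set_borel_measurable lebesgue ?A (\<lambda>t. poly p (cis t))"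
    unfolding set_borel_measurable_def
    using m angles_I(1) by (intro borel_measurable_scaleR borel_measurable_indicator) auto
  ultimately show ?thesis
    by (simp add: in_L2_def)
qed

text \<open>On the circle a polynomial is bounded by the sum of the moduli of its coefficients.
  Hence coefficientwise convergence implies convergence in \<open>nrm\<close>.\<close>

lemma nrm_le_sum_coeffs:
  assumes "p \<in> polys n"
  shows "nrm p \<le> L2_norm (arcI \<theta>) (\<lambda>_. 1) * (\<Sum>i\<le>n. cmod (coeff p i))"
proof (rule power2_le_imp_le)
  let ?A = "angles (arcI \<theta>)" and ?S = "\<Sum>i\<le>n. cmod (coeff p i)"
  have S: "0 \<le> ?S"
    by (intro sum_nonneg) auto
  have "(LINT t:?A|lebesgue. (cmod (poly p (cis t)))\<^sup>2) \<le> (LINT t:?A|lebesgue. ?S\<^sup>2 * 1)"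
    using in_L2_poly cmod_poly_le_sum_coeffs[OF assms] set_integrable_const
    by (intro set_integral_mono) (auto simp: in_L2_def intro!: power_mono)
  also have "\<dots> = ?S\<^sup>2 * (LINT t:?A|lebesgue. 1)"
    by (rule set_integral_mult_right)
  finally show "(nrm p)\<^sup>2 \<le> (L2_norm (arcI \<theta>) (\<lambda>_. 1) * ?S)\<^sup>2"
    unfolding nrm_def power_mult_distrib L2_norm_power2 by (simp add: divide_right_mono mult.commute)
  show "0 \<le> L2_norm (arcI \<theta>) (\<lambda>_. 1) * ?S"
    using S L2_norm_nonneg by simp
qed

text \<open>Vanishing almost everywhere on a subarc means vanishing on all of it by continuity, and
  a nonzero polynomial has finitely many roots.\<close>

lemma nrm_eq_0D:
  assumes "nrm p = 0"
  shows "p = 0"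
proof (rule ccontr)
  assume "p \<noteq> 0"
  let ?A = "angles (arcI \<theta>)" and ?C = "{t. poly p (cis t) = 0}"
  have "(LINT t:?A|lebesgue. (cmod (poly p (cis t)))\<^sup>2) = 0"
    using assms L2_norm_power2[of "arcI \<theta>" "poly p"] by (simp add: nrm_def)
  then have ae: "AE t in lebesgue. indicator ?A t *\<^sub>R (cmod (poly p (cis t)))\<^sup>2 = 0"
    using in_L2_poly[of p] unfolding set_lebesgue_integral_def
    by (subst (asm) integral_nonneg_eq_0_iff_AE) (auto simp: in_L2_def set_integrable_def)
  have "closed ?C"
    by (intro closed_Collect_eq continuous_intros)
  moreover have "AE t\<in>{\<theta><..<pi} in lebesgue. t \<in> ?C"
    using ae by eventually_elim (use theta_pos in \<open>auto simp: angles_arcI[OF theta_less_pi]\<close>)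
  ultimately have C: "{\<theta><..<pi} \<subseteq> ?C"
    by (rule closed_superset_interval_if_AE)
  have "inj_on cis {\<theta><..<pi}"
    using theta_pos Arg_cis by (intro inj_on_inverseI[where g=Arg]) auto
  then have "infinite (cis ` {\<theta><..<pi})"
    using theta_less_pi by (simp add: finite_image_iff)
  moreover have "cis ` {\<theta><..<pi} \<subseteq> {z. poly p z = 0}"
    using C by auto
  ultimately show False
    using poly_roots_finite[OF \<open>p \<noteq> 0\<close>] finite_subset by blast
qed

lemma nrm_diff_le: "\<bar>nrm p - nrm q\<bar> \<le> nrm (p - q)"
proof -
  have "nrm p \<le> nrm q + nrm (p - q)" for p q
    using L2_norm_triangle[OF in_L2_poly in_L2_poly, of q "p - q"] by (simp add: nrm_def)
  from this[of p q] this[of q p] show ?thesis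
    by (simp add: abs_le_iff nrm_diff_commute[of q p])
qed

text \<open>The triangle inequality for \<open>f - g = (f - h) + (h - g)\<close>, used in both
  directions.\<close>

lemma E_diff_le: "\<bar>E g - E h\<bar> \<le> nrm (g - h)"
proof -
  have "E g \<le> E h + nrm (h - g)" for g h
    using L2_norm_triangle[OF in_L2_diff[OF f_in_L2 in_L2_poly] in_L2_poly, of h "h - g"]
    by (simp add: nrm_def err_def)
  from this[of g h] this[of h g] show ?thesis
    by (simp add: abs_le_iff nrm_diff_commute[of h g])
qed

lemma nrm_diff_tendsto_0:
  assumes "\<And>j. p j \<in> polys n" "q \<in> polys n" "coeffs_tendsto p q"
  shows "(\<lambda>j. nrm (p j - q)) \<longlonglongrightarrow> 0"
proof (rule tendsto_sandwich)
  let ?K = "L2_norm (arcI \<theta>) (\<lambda>_. 1)"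
  show "\<forall>\<^sub>F j in sequentially. 0 \<le> nrm (p j - q)"
    by (simp add: nrm_nonneg)
  show "\<forall>\<^sub>F j in sequentially. nrm (p j - q) \<le> ?K * (\<Sum>i\<le>n. cmod (coeff (p j - q) i))"
    using assms by (intro always_eventually allI nrm_le_sum_coeffs in_polys_diff)
  have "(\<lambda>j. ?K * (\<Sum>i\<le>n. cmod (coeff (p j - q) i))) \<longlonglongrightarrow> ?K * (\<Sum>i\<le>n. cmod (coeff 0 i))"
    using coeffs_tendsto_diff_const[OF assms(3)] unfolding coeffs_tendsto_def
    by (intro tendsto_intros) auto
  then show "(\<lambda>j. ?K * (\<Sum>i\<le>n. cmod (coeff (p j - q) i))) \<longlonglongrightarrow> 0"
    by simp
qed simp

lemma nrm_tendsto:
  assumes "\<And>j. p j \<in> polys n" "q \<in> polys n" "coeffs_tendsto p q"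
  shows "(\<lambda>j. nrm (p j)) \<longlonglongrightarrow> nrm q"
  by (rule LIM_zero_cancel, rule Lim_null_comparison[OF _ nrm_diff_tendsto_0[OF assms]])
    (simp add: nrm_diff_le)

lemma E_tendsto:
  assumes "\<And>j. p j \<in> polys n" "q \<in> polys n" "coeffs_tendsto p q"
  shows "(\<lambda>j. E (p j)) \<longlonglongrightarrow> E q"
  by (rule LIM_zero_cancel, rule Lim_null_comparison[OF _ nrm_diff_tendsto_0[OF assms]])
    (simp add: E_diff_le)

text \<open>Equivalence of norms in finite dimension: \<open>nrm\<close> has a positive minimum on
  the unit sphere of the coefficient norm \<open>S\<close>, and homogeneity extends the bound to all
  of \<open>polys n\<close>.\<close>

lemma nrm_coercive:
  obtains c where "0 < c" "\<And>p i. p \<in> polys n \<Longrightarrow> cmod (coeff p i) \<le> c * nrm p"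
proof -
  define S where "S p = (\<Sum>i\<le>n. cmod (coeff p i))" for p :: "complex poly"
  have S_ge: "cmod (coeff p i) \<le> S p" if "p \<in> polys n" for p i
  proof (cases "i \<le> n")
    case True
    then show ?thesis unfolding S_def by (intro member_le_sum) auto
  next
    case False
    then show ?thesis using that by (simp add: S_def polys_def coeff_eq_0 sum_nonneg)
  qed
  define C where "C = {p \<in> polys n. S p = 1}"
  have "\<exists>g. is_arg_min nrm (\<lambda>g. g \<in> C) g"
  proof (rule polys_attains_min)
    have "S 1 = (\<Sum>i\<le>n. if i = 0 then 1 else 0)"
      unfolding S_def by (intro sum.cong) auto
    then have "1 \<in> C"
      by (simp add: C_def polys_def)
    then show "C \<noteq> {}" by blast
    \<comment> \<open>On this sphere the coefficients are already bounded by 1, so the coercivity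
      condition costs nothing.\<close>
    show "cmod (coeff g i) \<le> 1 * nrm g + 1" if "g \<in> C" for g i
      using that S_ge[of g i] nrm_nonneg[of g] by (simp add: C_def)
    show "q \<in> C \<and> (\<lambda>j. nrm (p j)) \<longlonglongrightarrow> nrm q"
      if "\<And>j. p j \<in> C" "q \<in> polys n" "coeffs_tendsto p q" for p q
    proof -
      have "(\<lambda>j. S (p j)) \<longlonglongrightarrow> S q"
        using that(3) unfolding coeffs_tendsto_def S_def by (intro tendsto_intros) auto
      then have "S q = 1"
        using that(1) by (simp add: C_def LIMSEQ_const_iff)
      with that nrm_tendsto[of p q] show ?thesis
        by (simp add: C_def)
    qed
  qed (auto simp: C_def)
  then obtain g where g: "g \<in> C" "\<And>h. h \<in> C \<Longrightarrow> nrm g \<le> nrm h"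
    by (auto simp: is_arg_min_linorder)
  have "nrm g \<noteq> 0"
    using nrm_eq_0D[of g] g(1) by (auto simp: C_def S_def)
  then have pos: "0 < nrm g"
    using nrm_nonneg[of g] by simp
  have "cmod (coeff p i) \<le> inverse (nrm g) * nrm p" if p: "p \<in> polys n" for p i
  proof (cases "S p = 0")
    case True
    then show ?thesis using S_ge[OF p, of i] pos nrm_nonneg[of p] by simp
  next
    case False
    then have Sp: "0 < S p"
      using S_ge[OF p, of 0] by (smt (verit) norm_ge_zero)
    have S_smult: "S (smult c p) = cmod c * S p" for c
      by (simp add: S_def norm_mult sum_distrib_left)
    define c where "c = complex_of_real (inverse (S p))"
    have c: "cmod c = inverse (S p)"
      using Sp by (simp add: c_def norm_inverse)
    have cp: "smult c p \<in> C"
      using p Sp by (simp add: C_def in_polys_smult S_smult c)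
    have "nrm g \<le> inverse (S p) * nrm p"
      using g(2)[OF cp] by (simp add: nrm_smult c)
    then have "S p * nrm g \<le> nrm p"
      using Sp by (simp add: inverse_eq_divide pos_le_divide_eq mult.commute)
    then have "S p \<le> inverse (nrm g) * nrm p"
      using pos by (simp add: inverse_eq_divide pos_le_divide_eq)
    with S_ge[OF p, of i] show ?thesis by linarith
  qed
  then show ?thesis
    using that[of "inverse (nrm g)"] pos by simp
qed

text \<open>\<open>E 0\<close> is the norm of \<open>f\<close>, so
  \<open>nrm g \<le> E g + E 0\<close>, and \<open>nrm\<close> controls the coefficients.\<close>

lemma E_coercive:
  obtains a b where "0 < a" "\<And>g i. g \<in> polys n \<Longrightarrow> cmod (coeff g i) \<le> a * E g + b"
proof -
  obtain c where c: "0 < c" "\<And>p i. p \<in> polys n \<Longrightarrow> cmod (coeff p i) \<le> c * nrm p"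
    using nrm_coercive by blast
  have "nrm g \<le> E g + E 0" for g
  proof -
    have "poly g = (\<lambda>z. f z - poly 0 z + (- 1) * (f z - poly g z))"
      by auto
    then have "nrm g \<le> E 0 + L2_norm (arcI \<theta>) (\<lambda>z. (- 1) * (f z - poly g z))"
      unfolding nrm_def err_def using f_in_L2 in_L2_poly
      by (metis (no_types) L2_norm_triangle in_L2_diff in_L2_cmult)
    then show ?thesis
      unfolding L2_norm_cmult by (simp add: err_def)
  qed
  then have "cmod (coeff g i) \<le> c * E g + c * E 0" if "g \<in> polys n" for g i
    using c(2)[OF that, of i] mult_left_mono[of "nrm g" "E g + E 0" c] c(1) by (smt (verit) distrib_left)
  with c(1) show ?thesis using that by blast
qed

lemma E_midpoint: "(E (midpoint_poly g h))\<^sup>2 = ((E g)\<^sup>2 + (E h)\<^sup>2) / 2 - (nrm (g - h))\<^sup>2 / 4"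
proof -
  have "(\<lambda>z. f z - poly (midpoint_poly g h) z) = (\<lambda>z. ((f z - poly g z) + (f z - poly h z)) / 2)"
    by (auto simp: poly_midpoint field_simps)
  then show ?thesis
    using L2_norm_parallelogram[OF in_L2_diff[OF f_in_L2 in_L2_poly] in_L2_diff[OF f_in_L2 in_L2_poly], of g h]
    by (simp add: err_def nrm_diff L2_norm_minus_commute[of "arcI \<theta>" "poly g" "poly h"])
qed

text \<open>The squared mean of two numbers is the mean of their squares less a quarter of the
  squared difference. Here the difference is at most \<open>nrm (g - h)\<close>, so
  \<open>E_midpoint\<close> gives the bound.\<close>

lemma E_midpoint_le: "E (midpoint_poly g h) \<le> (E g + E h) / 2"
proof (rule power2_le_imp_le)
  have "(E g - E h)\<^sup>2 \<le> (nrm (g - h))\<^sup>2"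
    using E_diff_le[of g h] nrm_nonneg[of "g - h"] by (simp add: abs_le_square_iff[symmetric])
  then show "(E (midpoint_poly g h))\<^sup>2 \<le> ((E g + E h) / 2)\<^sup>2"
    unfolding E_midpoint by (simp add: power2_eq_square field_simps)
  show "0 \<le> (E g + E h) / 2"
    using E_nonneg[of g] E_nonneg[of h] by simp
qed

text \<open>For equal errors the parallelogram law makes the midpoint strictly better unless
  \<open>nrm (g - h) = 0\<close>. All uniqueness statements rest on this.\<close>

lemma eq_if_E_midpoint_ge:
  assumes "E g = E h" "E g \<le> E (midpoint_poly g h)"
  shows "g = h"
proof -
  have "(E g)\<^sup>2 \<le> (E (midpoint_poly g h))\<^sup>2"
    using assms(2) E_nonneg by (intro power_mono)
  then have "nrm (g - h) = 0"
    unfolding E_midpoint assms(1) by simp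
  then show ?thesis
    using nrm_eq_0D by fastforce
qed

lemma ex1_best_bounded_poly: "\<exists>!k. is_arg_min E (\<lambda>g. g \<in> bounded_polys n Z) k"
proof (rule ex_ex1I)
  obtain a b where "0 < a" "\<And>g i. g \<in> polys n \<Longrightarrow> cmod (coeff g i) \<le> a * E g + b"
    using E_coercive by blast
  then show "\<exists>k. is_arg_min E (\<lambda>g. g \<in> bounded_polys n Z) k"
    using bounded_polys_subset zero_in_bounded_polys bounded_polys_limit E_tendsto
    by (intro polys_attains_min[where a = a and b = b and n = n]) blast+
next
  fix g h
  assume "is_arg_min E (\<lambda>g. g \<in> bounded_polys n Z) g" "is_arg_min E (\<lambda>g. g \<in> bounded_polys n Z) h"
  then have "g \<in> bounded_polys n Z" "h \<in> bounded_polys n Z"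
    "\<And>p. p \<in> bounded_polys n Z \<Longrightarrow> E g \<le> E p" "E g = E h"
    by (auto simp: is_arg_min_linorder intro: antisym)
  then show "g = h"
    by (intro eq_if_E_midpoint_ge) (auto intro: bounded_polys_midpoint)
qed

text \<open>Errors are bounded below by 0, so attaining the infimum is the same as being a
  minimiser.\<close>

lemma is_pbep_solution_iff:
  "is_pbep_solution \<theta> f n k \<longleftrightarrow> is_arg_min E (\<lambda>g. g \<in> bounded_polys n (arcJ \<theta>)) k"
proof -
  let ?C = "bounded_polys n (arcJ \<theta>)"
  have bdd: "bdd_below (E ` ?C)"
    using E_nonneg by (auto simp: bdd_below_def)
  have "E k = (INF g\<in>?C. E g) \<longleftrightarrow> (\<forall>g\<in>?C. E k \<le> E g)" if "k \<in> ?C"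
    using cINF_lower[OF bdd] that by (auto intro!: cInf_eq_minimum[symmetric])
  then show ?thesis
    unfolding is_pbep_solution_def pbep_feasible_eq[OF theta_pos theta_less_pi] is_arg_min_linorder
    by auto
qed

end

subsection \<open>Lagrangian duality\<close>

lemma nonneg_mult_fun_upd:
  "l \<in> nonneg_mult m \<Longrightarrow> 0 \<le> x \<Longrightarrow> l(k := x) \<in> nonneg_mult m"
  by (simp add: nonneg_mult_def)

lemma lagrangian_zero: "lagrangian \<theta> f m l 0 = err \<theta> f 0 - (\<Sum>k=0..m. l k)"
  by (simp add: lagrangian_def sum_negf)

text \<open>Each penalty term is at least \<open>- l k\<close>. This transfers coercivity from the
  error to the Lagrangian.\<close>

lemma lagrangian_ge:
  assumes "l \<in> nonneg_mult m"
  shows "err \<theta> f g - (\<Sum>k=0..m. l k) \<le> lagrangian \<theta> f m l g"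
proof -
  have "(\<Sum>k=0..m. - l k) \<le> (\<Sum>k=0..m. l k * ((cmod (poly g (cis (node \<theta> m k))))\<^sup>2 - 1))"
    using assms by (intro sum_mono) (simp add: nonneg_mult_def right_diff_distrib)
  then show ?thesis
    by (simp add: lagrangian_def sum_negf)
qed

text \<open>Linearity in the multiplier: comparing optimal values before and after the change
  reveals the sign of the constraint at node \<open>k\<close>.\<close>

lemma lagrangian_fun_upd:
  assumes "k \<le> m"
  shows "lagrangian \<theta> f m (l(k := l k + e)) g
    = lagrangian \<theta> f m l g + e * ((cmod (poly g (cis (node \<theta> m k))))\<^sup>2 - 1)"
proof -
  let ?c = "\<lambda>i. (cmod (poly g (cis (node \<theta> m i))))\<^sup>2 - 1"
  have "(\<Sum>i=0..m. (l(k := l k + e)) i * ?c i) = (\<Sum>i=0..m. l i * ?c i + (if i = k then e * ?c k else 0))"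
    by (intro sum.cong) (auto simp: distrib_right)
  also have "\<dots> = (\<Sum>i=0..m. l i * ?c i) + e * ?c k"
    using assms by (simp add: sum.distrib)
  finally show ?thesis
    by (simp add: lagrangian_def)
qed

lemma lagrangian_convex_combination:
  assumes "u + v = 1"
  shows "lagrangian \<theta> f m (\<lambda>k. u * l k + v * l' k) g
    = u * lagrangian \<theta> f m l g + v * lagrangian \<theta> f m l' g"
proof -
  let ?c = "\<lambda>i. (cmod (poly g (cis (node \<theta> m i))))\<^sup>2 - 1"
  have "(\<Sum>k=0..m. (u * l k + v * l' k) * ?c k)
    = u * (\<Sum>k=0..m. l k * ?c k) + v * (\<Sum>k=0..m. l' k * ?c k)"
    by (simp add: sum_distrib_left distrib_right mult.assoc sum.distrib)
  moreover have "err \<theta> f g = u * err \<theta> f g + v * err \<theta> f g"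
    using assms by (simp flip: distrib_right)
  ultimately show ?thesis
    unfolding lagrangian_def distrib_left by linarith
qed

text \<open>The parallelogram law at every node; \<open>lagrangian - err\<close> is the penalty. The
  last sum is the gain from strict convexity of the squared modulus.\<close>

lemma lagrangian_midpoint:
  "lagrangian \<theta> f m l (midpoint_poly g h) = err \<theta> f (midpoint_poly g h)
    + (lagrangian \<theta> f m l g - err \<theta> f g + (lagrangian \<theta> f m l h - err \<theta> f h)) / 2
    - (\<Sum>k=0..m. l k * (cmod (poly g (cis (node \<theta> m k)) - poly h (cis (node \<theta> m k))))\<^sup>2) / 4"
proof -
  let ?z = "\<lambda>k. cis (node \<theta> m k)"
  have parallelogram: "(cmod ((x + y) / 2))\<^sup>2 - 1
      = ((cmod x)\<^sup>2 - 1) / 2 + ((cmod y)\<^sup>2 - 1) / 2 - (cmod (x - y))\<^sup>2 / 4" for x y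
    unfolding cmod_power2 by (simp add: power2_eq_square field_simps)
  have "(\<Sum>k=0..m. l k * ((cmod (poly (midpoint_poly g h) (?z k)))\<^sup>2 - 1))
    = (\<Sum>k=0..m. l k * ((cmod (poly g (?z k)))\<^sup>2 - 1)) / 2
      + (\<Sum>k=0..m. l k * ((cmod (poly h (?z k)))\<^sup>2 - 1)) / 2
      - (\<Sum>k=0..m. l k * (cmod (poly g (?z k) - poly h (?z k)))\<^sup>2) / 4"
    unfolding poly_midpoint parallelogram sum_divide_distrib sum.distrib[symmetric] sum_subtractf[symmetric]
    by (simp add: right_diff_distrib distrib_left)
  then show ?thesis
    unfolding lagrangian_def by simp
qed

context extremal_problem
begin

abbreviation "L \<equiv> lagrangian \<theta> f"

abbreviation "is_lagrangian_min m l \<equiv> is_arg_min (L m l) (\<lambda>g. g \<in> polys n)"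

abbreviation "is_dual_max m \<equiv> is_arg_max (dual_fun \<theta> f n m) (\<lambda>l. l \<in> nonneg_mult m)"

lemma lagrangian_tendsto:
  assumes "\<And>j. p j \<in> polys n" "q \<in> polys n" "coeffs_tendsto p q"
    and "\<And>k. k \<in> {0..m} \<Longrightarrow> (\<lambda>j. l j k) \<longlonglongrightarrow> l' k"
  shows "(\<lambda>j. L m (l j) (p j)) \<longlonglongrightarrow> L m l' q"
  unfolding lagrangian_def
  using assms(4) E_tendsto[OF assms(1-3)] poly_tendsto[OF assms(1-3) tendsto_const]
  by (intro tendsto_intros) auto

lemma ex_lagrangian_min:
  assumes "l \<in> nonneg_mult m"
  shows "\<exists>g. is_lagrangian_min m l g"
proof -
  obtain a b where ab: "0 < a" "\<And>g i. g \<in> polys n \<Longrightarrow> cmod (coeff g i) \<le> a * E g + b"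
    using E_coercive by blast
  show ?thesis
  proof (rule polys_attains_min[where a = a and n = n])
    show "polys n \<noteq> {}"
      using zero_in_polys by blast
    show "cmod (coeff g i) \<le> a * L m l g + (a * (\<Sum>k=0..m. l k) + b)" if "g \<in> polys n" for g i
    proof -
      have "a * E g \<le> a * (L m l g + (\<Sum>k=0..m. l k))"
        using lagrangian_ge[OF assms, of \<theta> f g] ab(1) by (intro mult_left_mono) auto
      with ab(2)[OF that, of i] show ?thesis
        unfolding distrib_left by linarith
    qed
    show "q \<in> polys n \<and> (\<lambda>j. L m l (p j)) \<longlonglongrightarrow> L m l q"
      if "\<And>j. p j \<in> polys n" "q \<in> polys n" "coeffs_tendsto p q" for p q
      using that lagrangian_tendsto[OF that, of m "\<lambda>_. l" l] by simp
  qed (use ab in auto)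
qed

text \<open>The norm is not strictly convex and the penalty sees only the nodes with a positive
  multiplier, so neither summand alone gives uniqueness. Strict convexity of \<open>|\<cdot>|\<^sup>2\<close> makes two
  minimisers agree at these nodes; hence they have the same penalty and the same distance to \<open>f\<close>,
  and the parallelogram law applies.\<close>

lemma lagrangian_min_unique:
  assumes l: "l \<in> nonneg_mult m" and g: "is_lagrangian_min m l g" and h: "is_lagrangian_min m l h"
  shows "g = h"
proof -
  let ?z = "\<lambda>k. cis (node \<theta> m k)" and ?M = "midpoint_poly g h"
  let ?D = "\<lambda>k. l k * (cmod (poly g (?z k) - poly h (?z k)))\<^sup>2"
  have mem: "g \<in> polys n" "h \<in> polys n" and le: "\<And>p. p \<in> polys n \<Longrightarrow> L m l g \<le> L m l p"
    and eq: "L m l g = L m l h"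
    using g h by (auto simp: is_arg_min_linorder intro: antisym)
  have le_M: "L m l g \<le> L m l ?M"
    using mem by (intro le in_polys_midpoint)
  have D: "0 \<le> ?D k" if "k \<in> {0..m}" for k
    using l that by (simp add: nonneg_mult_def)
  \<comment> \<open>By midpoint convexity of \<open>E\<close>, the value at \<open>?M\<close> is at
    most the common minimum less a quarter of this sum.\<close>
  have "(\<Sum>k=0..m. ?D k) \<le> 0"
    using le_M eq E_midpoint_le[of g h] unfolding lagrangian_midpoint by argo
  then have D0: "(\<Sum>k=0..m. ?D k) = 0"
    using sum_nonneg[of "{0..m}" ?D, OF D] by linarith
  have "l k * ((cmod (poly g (?z k)))\<^sup>2 - 1) = l k * ((cmod (poly h (?z k)))\<^sup>2 - 1)"
    if k: "k \<in> {0..m}" for k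
  proof -
    have "?D k = 0"
      using D0 k D by (subst (asm) sum_nonneg_eq_0_iff) auto
    then show ?thesis
      by (cases "l k = 0") auto
  qed
  then have "L m l g - E g = L m l h - E h"
    unfolding lagrangian_def add_diff_cancel_left' by (rule sum.cong[OF refl])
  with eq have "E g = E h"
    by simp
  moreover have "E g \<le> E ?M"
    using le_M eq \<open>E g = E h\<close> unfolding lagrangian_midpoint D0 by argo
  ultimately show ?thesis
    by (rule eq_if_E_midpoint_ge)
qed

section \<open>The dual function: concavity and attainment of the maximum\<close>

lemma dual_fun_eq:
  assumes "is_lagrangian_min m l g"
  shows "dual_fun \<theta> f n m l = L m l g"
  unfolding dual_fun_def using assms
  by (intro cInf_eq_minimum) (auto simp: is_arg_min_linorder)

text \<open>Existence of a minimiser makes the infimum a genuine lower bound.\<close>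

lemma dual_fun_le:
  assumes "l \<in> nonneg_mult m" "g \<in> polys n"
  shows "dual_fun \<theta> f n m l \<le> L m l g"
proof -
  obtain h where h: "is_lagrangian_min m l h"
    using ex_lagrangian_min[OF assms(1)] by blast
  show ?thesis
    unfolding dual_fun_eq[OF h] using h assms(2) by (simp add: is_arg_min_linorder)
qed

text \<open>The Lagrangian is affine in the multiplier; testing both dual values with the minimiser
  for the combined multiplier gives the inequality.\<close>

lemma concave_dual_fun: "concave_on_mult m (dual_fun \<theta> f n m)"
  unfolding concave_on_mult_def
proof (intro ballI allI impI)
  fix l l' u v
  assume l: "l \<in> nonneg_mult m" "l' \<in> nonneg_mult m" and uv: "0 \<le> u" "0 \<le> v" "u + v = (1::real)"
  let ?l = "\<lambda>k. u * l k + v * l' k"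
  have "?l \<in> nonneg_mult m"
    using l uv by (simp add: nonneg_mult_def)
  then obtain g where g: "is_lagrangian_min m ?l g"
    using ex_lagrangian_min by blast
  then have "g \<in> polys n"
    by (simp add: is_arg_min_def)
  then have "u * dual_fun \<theta> f n m l + v * dual_fun \<theta> f n m l' \<le> u * L m l g + v * L m l' g"
    using l uv by (intro add_mono mult_left_mono dual_fun_le)
  then show "u * dual_fun \<theta> f n m l + v * dual_fun \<theta> f n m l' \<le> dual_fun \<theta> f n m ?l"
    unfolding dual_fun_eq[OF g] lagrangian_convex_combination[OF uv(3)] .
qed

lemma ex_dual_max: "\<exists>l. is_dual_max m l"
proof -
  let ?q = "dual_fun \<theta> f n m" and ?N = "nonneg_mult m"
  have le: "?q l + (\<Sum>k=0..m. l k) \<le> E 0" if "l \<in> ?N" for l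
    using dual_fun_le[OF that zero_in_polys] by (simp add: lagrangian_zero)
  have "?q l \<le> E 0" if "l \<in> ?N" for l
    using le[OF that] that sum_nonneg[of "{0..m}" l] by (fastforce simp: nonneg_mult_def)
  then have bdd: "bdd_above (?q ` ?N)"
    by (auto simp: bdd_above_def)
  have "(\<lambda>_. 0) \<in> ?N"
    by (simp add: nonneg_mult_def)
  then have ne: "?N \<noteq> {}"
    by blast
  define v where "v = (SUP l\<in>?N. ?q l)"
  have "\<exists>l\<in>?N. v - inverse (real (Suc j)) < ?q l" for j
    using less_cSUP_iff[OF ne bdd, of "v - inverse (real (Suc j))"] by (simp add: v_def)
  then obtain l where l: "\<And>j. l j \<in> ?N" "\<And>j. v - inverse (real (Suc j)) < ?q (l j)"
    by metis
  \<comment> \<open>Testing with the zero polynomial bounds the sum of the multipliers along the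
    maximising sequence.\<close>
  have "\<bar>l j k\<bar> \<le> E 0 - v + 1" if k: "k \<in> {0..m}" for j k
  proof -
    have "l j k \<le> (\<Sum>i=0..m. l j i)"
      using k l(1)[of j] by (intro member_le_sum) (auto simp: nonneg_mult_def)
    moreover have "inverse (real (Suc j)) \<le> 1"
      by (simp add: inverse_le_1_iff)
    ultimately have "l j k \<le> E 0 - v + 1"
      using le[OF l(1)[of j]] l(2)[of j] by linarith
    moreover have "0 \<le> l j k"
      using k l(1)[of j] by (simp add: nonneg_mult_def)
    ultimately show ?thesis
      by simp
  qed
  then have "bounded (range (\<lambda>j. l j k))" if "k \<in> {0..m}" for k
    using that by (auto simp: bounded_iff)
  then obtain r l' where r: "strict_mono r" "\<And>k. k \<in> {0..m} \<Longrightarrow> (\<lambda>j. l (r j) k) \<longlonglongrightarrow> l' k"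
    using finite_convergent_subsequence[of "{0..m}" l] by auto
  have "0 \<le> l' k" if "k \<in> {0..m}" for k
    using l(1) that by (intro LIMSEQ_le_const[OF r(2)[OF that]]) (auto simp: nonneg_mult_def)
  then have l': "l' \<in> ?N"
    by (simp add: nonneg_mult_def)
  then obtain g where g: "is_lagrangian_min m l' g"
    using ex_lagrangian_min by blast
  then have gp: "g \<in> polys n"
    by (simp add: is_arg_min_def)
  \<comment> \<open>Upper semicontinuity: \<open>g\<close> is fixed as the minimiser at the limit
    \<open>l'\<close>, and \<open>L m (l (r j)) g\<close> dominates the dual values along the
    sequence.\<close>
  have "(\<lambda>j. L m (l (r j)) g) \<longlonglongrightarrow> L m l' g"
    using gp r(2) by (intro lagrangian_tendsto) (auto simp: coeffs_tendsto_def)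
  moreover have "(\<lambda>j. v - inverse (real (Suc (r j)))) \<longlonglongrightarrow> v - 0"
    using LIMSEQ_subseq_LIMSEQ[OF LIMSEQ_inverse_real_of_nat r(1)]
    by (intro tendsto_diff tendsto_const) (simp add: o_def)
  moreover have "v - inverse (real (Suc (r j))) \<le> L m (l (r j)) g" for j
    using l(2)[of "r j"] dual_fun_le[OF l(1) gp, of "r j"] by linarith
  ultimately have "v \<le> ?q l'"
    unfolding dual_fun_eq[OF g] using LIMSEQ_le by fastforce
  then have "?q l'' \<le> ?q l'" if "l'' \<in> ?N" for l''
    using cSUP_upper[OF that bdd] by (simp add: v_def)
  with l' have "is_dual_max m l'"
    by (auto simp: is_arg_max_def not_less)
  then show ?thesis by blast
qed

text \<open>One-sided derivatives of the dual function: the minimisers of the perturbed Lagrangians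
  converge to the unique minimiser of \<open>L m l\<close>.\<close>

lemma dual_max_perturbation:
  assumes l: "is_dual_max m l" and g: "is_lagrangian_min m l g" and k: "k \<le> m"
    and e: "e \<longlonglongrightarrow> 0" "\<And>j. 0 \<le> l k + e j"
  obtains p where "\<And>j. p j \<in> polys n" "coeffs_tendsto p g"
    "\<And>j. e j * ((cmod (poly (p j) (cis (node \<theta> m k))))\<^sup>2 - 1) \<le> 0"
proof -
  define le where "le j = l(k := l k + e j)" for j
  have lN: "l \<in> nonneg_mult m" and l_max: "\<And>l'. l' \<in> nonneg_mult m \<Longrightarrow> dual_fun \<theta> f n m l' \<le> dual_fun \<theta> f n m l"
    using l by (auto simp: is_arg_max_def not_less)
  have leN: "le j \<in> nonneg_mult m" for j
    using lN e(2) unfolding le_def by (intro nonneg_mult_fun_upd)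
  obtain p where p: "\<And>j. is_lagrangian_min m (le j) (p j)"
    using ex_lagrangian_min[OF leN] by metis
  have pn: "p j \<in> polys n" and p_min: "\<And>h. h \<in> polys n \<Longrightarrow> L m (le j) (p j) \<le> L m (le j) h" for j
    using p[of j] by (auto simp: is_arg_min_linorder)
  have g_min: "\<And>h. h \<in> polys n \<Longrightarrow> L m l g \<le> L m l h"
    using g by (auto simp: is_arg_min_linorder)
  have le_lim: "(\<lambda>j. le j i) \<longlonglongrightarrow> l i" for i
    using tendsto_add[OF tendsto_const e(1), of "l k"] by (cases "i = k") (auto simp: le_def)
  have "coeffs_tendsto p g"
  proof -
    obtain a b where ab: "0 < a" "\<And>g i. g \<in> polys n \<Longrightarrow> cmod (coeff g i) \<le> a * E g + b"
      using E_coercive by blast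
    \<comment> \<open>Comparison with the zero polynomial: the multiplier sums cancel, so the bound
      does not depend on the perturbation.\<close>
    have "E (p j) \<le> E 0" for j
      using lagrangian_ge[OF leN, of \<theta> f "p j" j] p_min[OF zero_in_polys, of j]
      unfolding lagrangian_zero by linarith
    then have "a * E (p j) \<le> a * E 0" for j
      using ab(1) by (intro mult_left_mono) auto
    then have "cmod (coeff (p j) i) \<le> a * E 0 + b" for j i
      using ab(2)[OF pn, of j i] by (meson add_right_mono order_trans)
    moreover have "q = g" if r: "strict_mono r" "q \<in> polys n" "coeffs_tendsto (p \<circ> r) q" for r q
    proof (rule lagrangian_min_unique[OF lN _ g])
      have lim: "(\<lambda>j. le (r j) i) \<longlonglongrightarrow> l i" for i
        using LIMSEQ_subseq_LIMSEQ[OF le_lim r(1)] by (simp add: o_def)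
      have "L m l q \<le> L m l h" if "h \<in> polys n" for h
      proof (rule LIMSEQ_le)
        show "(\<lambda>j. L m (le (r j)) ((p \<circ> r) j)) \<longlonglongrightarrow> L m l q"
          using pn r lim by (intro lagrangian_tendsto[of "p \<circ> r"]) auto
        show "(\<lambda>j. L m (le (r j)) h) \<longlonglongrightarrow> L m l h"
          using that lim by (intro lagrangian_tendsto) (auto simp: coeffs_tendsto_def)
        show "\<exists>N. \<forall>j\<ge>N. L m (le (r j)) ((p \<circ> r) j) \<le> L m (le (r j)) h"
          using p_min[OF that] by auto
      qed
      with r(2) show "is_lagrangian_min m l q"
        by (simp add: is_arg_min_linorder)
    qed
    ultimately show ?thesis
      using pn by (intro coeffs_tendsto_if_unique_cluster_point)
  qed
  moreover have "e j * ((cmod (poly (p j) (cis (node \<theta> m k))))\<^sup>2 - 1) \<le> 0" for j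
  proof -
    \<comment> \<open>Maximality of \<open>l\<close> compares the two dual values; minimality of
      \<open>g\<close> then replaces \<open>g\<close> by \<open>p j\<close>, leaving only the
      perturbed term.\<close>
    have "L m (le j) (p j) \<le> L m l g"
      using l_max[OF leN, of j] by (simp only: dual_fun_eq[OF p] dual_fun_eq[OF g])
    also have "\<dots> \<le> L m l (p j)"
      using pn by (rule g_min)
    finally show ?thesis
      unfolding le_def lagrangian_fun_upd[OF k] by simp
  qed
  ultimately show ?thesis
    using that pn by blast
qed

text \<open>Increasing \<open>l k\<close> slightly yields feasibility at node \<open>k\<close>;
  decreasing it, possible only if \<open>l k > 0\<close>, yields the reverse inequality and thus
  complementary slackness.\<close>

lemma dual_max_KKT:
  assumes l: "is_dual_max m l" and g: "is_lagrangian_min m l g" and k: "k \<le> m"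
  shows "cmod (poly g (cis (node \<theta> m k))) \<le> 1"
    and "l k * ((cmod (poly g (cis (node \<theta> m k))))\<^sup>2 - 1) = 0"
proof -
  let ?z = "cis (node \<theta> m k)"
  have gn: "g \<in> polys n" and lk: "0 \<le> l k"
    using l g k by (auto simp: is_arg_min_def is_arg_max_def nonneg_mult_def)
  obtain p where p: "\<And>j. p j \<in> polys n" "coeffs_tendsto p g"
    "\<And>j. inverse (real (Suc j)) * ((cmod (poly (p j) ?z))\<^sup>2 - 1) \<le> 0"
    using dual_max_perturbation[OF l g k LIMSEQ_inverse_real_of_nat] lk by auto
  have "(cmod (poly (p j) ?z))\<^sup>2 \<le> 1" for j
    using p(3)[of j] by (simp add: mult_le_0_iff)
  moreover have "(\<lambda>j. (cmod (poly (p j) ?z))\<^sup>2) \<longlonglongrightarrow> (cmod (poly g ?z))\<^sup>2"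
    using p gn by (intro tendsto_intros poly_tendsto) auto
  ultimately have le: "(cmod (poly g ?z))\<^sup>2 \<le> 1"
    by (intro Lim_bounded) auto
  then show "cmod (poly g ?z) \<le> 1"
    by (simp add: abs_square_le_1)
  show "l k * ((cmod (poly g ?z))\<^sup>2 - 1) = 0"
  proof (cases "l k = 0")
    case False
    with lk have pos: "0 < l k"
      by simp
    have "(\<lambda>j. - l k * inverse (real (Suc j))) \<longlonglongrightarrow> - l k * 0"
      by (intro tendsto_mult tendsto_const LIMSEQ_inverse_real_of_nat)
    then have lim: "(\<lambda>j. - l k * inverse (real (Suc j))) \<longlonglongrightarrow> 0"
      by simp
    \<comment> \<open>Scaling the decrement by \<open>l k\<close> keeps the multiplier nonnegative;
      at \<open>j = 0\<close> it is exactly 0.\<close>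
    have "0 \<le> l k + - l k * inverse (real (Suc j))" for j
      using pos by (simp add: field_simps)
    from dual_max_perturbation[OF l g k lim this]
    obtain p where p: "\<And>j. p j \<in> polys n" "coeffs_tendsto p g"
      "\<And>j. - l k * inverse (real (Suc j)) * ((cmod (poly (p j) ?z))\<^sup>2 - 1) \<le> 0"
      by blast
    have "1 \<le> (cmod (poly (p j) ?z))\<^sup>2" for j
    proof -
      have "0 < l k * inverse (real (Suc j))"
        using pos by simp
      with p(3)[of j] show ?thesis
        using mult_neg_neg[of "- l k * inverse (real (Suc j))" "(cmod (poly (p j) ?z))\<^sup>2 - 1"] by linarith
    qed
    moreover have "(\<lambda>j. (cmod (poly (p j) ?z))\<^sup>2) \<longlonglongrightarrow> (cmod (poly g ?z))\<^sup>2"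
      using p gn by (intro tendsto_intros poly_tendsto) auto
    ultimately have "1 \<le> (cmod (poly g ?z))\<^sup>2"
      by (intro Lim_bounded2) auto
    with le show ?thesis
      by simp
  qed simp
qed

section \<open>Strong duality\<close>

lemma is_dbep_solution_iff:
  "is_dbep_solution \<theta> f n m k \<longleftrightarrow> is_arg_min E (\<lambda>g. g \<in> bounded_polys n (arcJ_disc \<theta> m)) k"
  by (simp add: is_dbep_solution_def dbep_feasible_eq)

lemma dbep_solution: "is_arg_min E (\<lambda>g. g \<in> bounded_polys n (arcJ_disc \<theta> m)) (dbep_solution \<theta> f n m)"
  using theI'[OF ex1_best_bounded_poly[of "arcJ_disc \<theta> m"]]
  by (simp add: dbep_solution_def is_dbep_solution_iff)

lemma dbep_solution_eqI:
  "is_arg_min E (\<lambda>g. g \<in> bounded_polys n (arcJ_disc \<theta> m)) g \<Longrightarrow> g = dbep_solution \<theta> f n m"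
  using ex1_best_bounded_poly[of "arcJ_disc \<theta> m"] dbep_solution by blast

text \<open>Complementary slackness removes the penalty at \<open>g\<close>, while it is nonpositive
  at every feasible \<open>h\<close>; hence
  \<open>E g = L m l g \<le> L m l h \<le> E h\<close>.\<close>

lemma lagrangian_min_dual_max_eq_dbep_solution:
  assumes l: "is_dual_max m l" and g: "is_lagrangian_min m l g"
  shows "g = dbep_solution \<theta> f n m"
proof (rule dbep_solution_eqI)
  let ?C = "bounded_polys n (arcJ_disc \<theta> m)"
  have gC: "g \<in> ?C"
    using g dual_max_KKT(1)[OF l g] by (auto simp: bounded_polys_def arcJ_disc_def is_arg_min_def)
  have "E g \<le> E h" if h: "h \<in> ?C" for h
  proof -
    have "(\<Sum>k=0..m. l k * ((cmod (poly g (cis (node \<theta> m k))))\<^sup>2 - 1)) = 0"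
      using dual_max_KKT(2)[OF l g] by (intro sum.neutral) auto
    then have "E g = L m l g"
      by (simp add: lagrangian_def)
    also have "\<dots> \<le> L m l h"
      using g h by (simp add: is_arg_min_linorder bounded_polys_def)
    also have "\<dots> \<le> E h"
      using l h unfolding lagrangian_def
      by (auto simp: is_arg_max_def nonneg_mult_def bounded_polys_def arcJ_disc_def abs_square_le_1
          intro!: sum_nonpos mult_nonneg_nonpos)
    finally show ?thesis .
  qed
  with gC show "is_arg_min E (\<lambda>g. g \<in> ?C) g"
    by (simp add: is_arg_min_linorder)
qed

lemma lagrangian_min_iff_eq_dbep_solution:
  assumes l: "is_dual_max m l"
  shows "is_lagrangian_min m l g \<longleftrightarrow> g = dbep_solution \<theta> f n m"
proof -
  have "l \<in> nonneg_mult m"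
    using l by (simp add: is_arg_max_def)
  then obtain h where "is_lagrangian_min m l h"
    using ex_lagrangian_min by blast
  then show ?thesis
    using lagrangian_min_dual_max_eq_dbep_solution[OF l] by blast
qed

subsection \<open>Refining the discretisation\<close>

lemma pbep_solution: "is_arg_min E (\<lambda>g. g \<in> bounded_polys n (arcJ \<theta>)) (pbep_solution \<theta> f n)"
  using theI'[OF ex1_best_bounded_poly[of "arcJ \<theta>"]]
  by (simp add: pbep_solution_def is_pbep_solution_iff)

lemma arcJ_disc_subset: "arcJ_disc \<theta> m \<subseteq> arcJ \<theta>"
proof -
  have "node \<theta> m k \<in> {-\<theta>..\<theta>}" if "k \<le> m" for k
  proof -
    \<comment> \<open>For \<open>m = 0\<close> the quotient is 0 by convention, so the bound still
      holds.\<close>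
    have "real k / real m \<le> 1"
      using that by (simp add: divide_le_eq)
    then have "real k / real m * \<theta> \<le> 1 * \<theta>"
      using theta_pos by (intro mult_right_mono) auto
    with theta_pos show ?thesis
      by (simp add: node_def)
  qed
  then show ?thesis
    by (auto simp: arcJ_disc_def arcJ_def)
qed

text \<open>With \<open>s\<close> the affine coordinate of \<open>t\<close> in the interval,
  rounding \<open>s * m\<close> down picks a node within one grid step of \<open>t\<close>.\<close>

lemma ex_nodes_tendsto:
  assumes t: "t \<in> {-\<theta>..\<theta>}"
  obtains i where "\<And>m. i m \<le> m" "(\<lambda>m. node \<theta> m (i m)) \<longlonglongrightarrow> t"
proof -
  define s where "s = (t + \<theta>) / (2 * \<theta>)"
  have s: "0 \<le> s" "s \<le> 1" "- \<theta> + 2 * \<theta> * s = t"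
    using t theta_pos by (auto simp: s_def field_simps)
  define i where "i m = nat \<lfloor>s * real m\<rfloor>" for m
  have floor: "real (i m) \<le> s * real m" "s * real m - 1 \<le> real (i m)" for m
  proof -
    have "real (i m) = of_int \<lfloor>s * real m\<rfloor>"
      using s(1) by (simp add: i_def)
    then show "real (i m) \<le> s * real m" "s * real m - 1 \<le> real (i m)"
      by linarith+
  qed
  have "i m \<le> m" for m
    using order_trans[OF floor(1)[of m] mult_right_mono[OF s(2), of "real m"]] by simp
  moreover have "(\<lambda>m. node \<theta> m (i m)) \<longlonglongrightarrow> t"
  proof -
    have "(\<lambda>m. real (i m) / real m) \<longlonglongrightarrow> s"
    proof (rule tendsto_sandwich)
      show "\<forall>\<^sub>F m in sequentially. s - 1 / real m \<le> real (i m) / real m"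
      proof (rule eventually_mono[OF eventually_gt_at_top[of 0]])
        fix m :: nat assume "0 < m"
        then show "s - 1 / real m \<le> real (i m) / real m"
          using divide_right_mono[OF floor(2)[of m], of "real m"] by (simp add: diff_divide_distrib)
      qed
      show "\<forall>\<^sub>F m in sequentially. real (i m) / real m \<le> s"
        using eventually_gt_at_top[of 0] by eventually_elim (use floor in \<open>simp add: field_simps\<close>)
      show "(\<lambda>m. s - 1 / real m) \<longlonglongrightarrow> s"
        using tendsto_diff[OF tendsto_const lim_1_over_n, of s] by simp
    qed simp
    then have "(\<lambda>m. - \<theta> + 2 * \<theta> * (real (i m) / real m)) \<longlonglongrightarrow> - \<theta> + 2 * \<theta> * s"
      by (intro tendsto_intros)
    then show ?thesis
      unfolding s(3) by (simp add: node_def mult.commute mult.left_commute)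
  qed
  ultimately show ?thesis
    using that by blast
qed

lemma dbep_solution_tendsto: "coeffs_tendsto (dbep_solution \<theta> f n) (pbep_solution \<theta> f n)"
proof -
  let ?d = "dbep_solution \<theta> f n" and ?p = "pbep_solution \<theta> f n"
  have d: "?d m \<in> bounded_polys n (arcJ_disc \<theta> m)"
    and d_min: "\<And>h. h \<in> bounded_polys n (arcJ_disc \<theta> m) \<Longrightarrow> E (?d m) \<le> E h" for m
    using dbep_solution[of m] by (auto simp: is_arg_min_linorder)
  have p: "?p \<in> bounded_polys n (arcJ \<theta>)"
    and p_min: "\<And>h. h \<in> bounded_polys n (arcJ \<theta>) \<Longrightarrow> E ?p \<le> E h"
    using pbep_solution by (auto simp: is_arg_min_linorder)
  have dn: "?d m \<in> polys n" for m
    using d bounded_polys_subset by blast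
  obtain a b where ab: "0 < a" "\<And>g i. g \<in> polys n \<Longrightarrow> cmod (coeff g i) \<le> a * E g + b"
    using E_coercive by blast
  \<comment> \<open>The zero polynomial is feasible for every grid, so the errors are bounded
    uniformly in \<open>m\<close>.\<close>
  have "a * E (?d m) \<le> a * E 0" for m
    using ab(1) d_min[OF zero_in_bounded_polys] by (intro mult_left_mono) auto
  then have "cmod (coeff (?d m) i) \<le> a * E 0 + b" for m i
    using ab(2)[OF dn, of m i] by (meson add_right_mono order_trans)
  moreover have "q = ?p" if r: "strict_mono r" "q \<in> polys n" "coeffs_tendsto (?d \<circ> r) q" for r q
  proof -
    have "cmod (poly q (cis t)) \<le> 1" if t: "t \<in> {-\<theta>..\<theta>}" for t
    proof -
      obtain i where i: "\<And>m. i m \<le> m" "(\<lambda>m. node \<theta> m (i m)) \<longlonglongrightarrow> t"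
        using ex_nodes_tendsto[OF t] by blast
      have "(\<lambda>j. node \<theta> (r j) (i (r j))) \<longlonglongrightarrow> t"
        using LIMSEQ_subseq_LIMSEQ[OF i(2) r(1)] by (simp add: o_def)
      then have "(\<lambda>j. cis (node \<theta> (r j) (i (r j)))) \<longlonglongrightarrow> cis t"
        by (rule tendsto_cis)
      then have "(\<lambda>j. cmod (poly ((?d \<circ> r) j) (cis (node \<theta> (r j) (i (r j)))))) \<longlonglongrightarrow> cmod (poly q (cis t))"
        using dn r by (intro tendsto_norm poly_tendsto[of "?d \<circ> r" n]) auto
      moreover have "cmod (poly (?d m) (cis (node \<theta> m (i m)))) \<le> 1" for m
        using d[of m] i(1)[of m] by (auto simp: bounded_polys_def arcJ_disc_def)
      ultimately show ?thesis
        by (intro Lim_bounded) auto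
    qed
    then have qC: "q \<in> bounded_polys n (arcJ \<theta>)"
      using r(2) by (auto simp: bounded_polys_def arcJ_def)
    \<comment> \<open>All nodes lie on the arc, so the solution for the arc competes in every
      discrete problem.\<close>
    have "E ((?d \<circ> r) j) \<le> E ?p" for j
    proof -
      have "?p \<in> bounded_polys n (arcJ_disc \<theta> (r j))"
        using p arcJ_disc_subset[of "r j"] unfolding bounded_polys_def by blast
      then show ?thesis
        using d_min by simp
    qed
    moreover have "(\<lambda>j. E ((?d \<circ> r) j)) \<longlonglongrightarrow> E q"
      using dn r by (intro E_tendsto[of "?d \<circ> r"]) auto
    ultimately have "E q \<le> E ?p"
      by (intro Lim_bounded) auto
    then have "is_arg_min E (\<lambda>g. g \<in> bounded_polys n (arcJ \<theta>)) q"
      using qC order_trans[OF _ p_min] by (simp add: is_arg_min_linorder)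
    then show ?thesis
      using ex1_best_bounded_poly[of "arcJ \<theta>"] pbep_solution by blast
  qed
  ultimately show ?thesis
    using dn by (intro coeffs_tendsto_if_unique_cluster_point)
qed

end

theorem theorem5:
  fixes n :: nat and \<theta> :: real and f :: "complex \<Rightarrow> complex"
  assumes "0 < \<theta>" and "\<theta> < pi"
    and "in_L2 (arcI \<theta>) f"
  shows "(\<forall>m\<ge>1. \<exists>!k. is_dbep_solution \<theta> f n m k) \<and>
    (\<forall>m\<ge>1.
      (\<forall>l\<in>nonneg_mult m. \<exists>g. is_arg_min (lagrangian \<theta> f m l) (\<lambda>g. g \<in> polys n) g) \<and>
      concave_on_mult m (dual_fun \<theta> f n m) \<and>
      (\<exists>l. is_arg_max (dual_fun \<theta> f n m) (\<lambda>l. l \<in> nonneg_mult m) l) \<and>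
      (\<forall>l. is_arg_max (dual_fun \<theta> f n m) (\<lambda>l. l \<in> nonneg_mult m) l \<longrightarrow>
        (\<forall>g. is_arg_min (lagrangian \<theta> f m l) (\<lambda>g. g \<in> polys n) g \<longleftrightarrow>
             g = dbep_solution \<theta> f n m))) \<and>
    (\<exists>!k. is_pbep_solution \<theta> f n k) \<and>
    (\<forall>i. (\<lambda>m. coeff (dbep_solution \<theta> f n m) i) \<longlonglongrightarrow> coeff (pbep_solution \<theta> f n) i)"
proof -
  interpret extremal_problem \<theta> f n
    using assms by unfold_locales
  have "\<exists>!k. is_dbep_solution \<theta> f n m k" for m
    unfolding is_dbep_solution_iff by (rule ex1_best_bounded_poly)
  moreover have "\<exists>!k. is_pbep_solution \<theta> f n k"
    unfolding is_pbep_solution_iff by (rule ex1_best_bounded_poly)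
  ultimately show ?thesis
    using ex_lagrangian_min concave_dual_fun ex_dual_max lagrangian_min_iff_eq_dbep_solution
      dbep_solution_tendsto unfolding coeffs_tendsto_def by blast
qed

end
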